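(* Let $x_k\in\mathcal X_0$, let $Q_k\succ0$ be symmetric, let $x_{k+1}=\arg\min_x\{F(x;x_k)+\tfrac12\|x-x_k\|_{Q_k}^2\}$, and define $\mathcal G_{Q_k}(x_k):=Q_k(x_k-x_{k+1})$ (so $Q_k^{-1}\mathcal G_{Q_k}(x_k)=x_k-x_{k+1}$). Then for all $y\in\mathbb R^m$: $$F(y;x_k)\ \ge\ F_{Q_k}(x_{k+1};x_k)+\langle\mathcal G_{Q_k}(x_k),y-x_k\rangle+\tfrac12\langle Q_k^{-1}\mathcal G_{Q_k}(x_k),\mathcal G_{Q_k}(x_k)\rangle .$$ If, in addition, $-\tfrac{L_L}{2}\|x-x_k\|^2\le F(x)-F(x;x_k)\le\tfrac{L_U}{2}\|x-x_k\|^2$ holds for all $x\in\operatorname{dom}F$ with constants $L_U,L_L$, and $\sigma_k:=\lambda_{\min}(Q_k)$, then for all $y\in\mathbb R^m$ $$F(y)\ \ge\ F(x_{k+1})+\langle\mathcal G_{Q_k}(x_k),y-x_k\rangle+\Big(1-\tfrac{L_U}{2\sigma_k}\Big)\langle Q_k^{-1}\mathcal G_{Q_k}(x_k),\mathcal G_{Q_k}(x_k)\rangle-\tfrac{L_L}{2}\|y-x_k\|^2 .$$ In particular, setting $y=x_k$, $$F(x_k)-F(x_{k+1})\ \ge\ \Big(1-\tfrac{L_U}{2\sigma_k}\Big)\langle Q_k^{-1}\mathcal G_{Q_k}(x_k),\mathcal G_{Q_k}(x_k)\rangle=\tfrac12\Big(2-\tfrac{L_U}{\sigma_k}\Big)\|x_{k+1}-x_k\|_{Q_k}^2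 .$$ When $Q_k=t^{-1}I$ with $t>0$ and $L_L=L_U=L$, the second inequality reduces to $$F(y)\ \ge\ F(x_{k+1})+\langle\mathcal G_{t^{-1}}(x_k),y-x_k\rangle+\tfrac t2(2-Lt)\|\mathcal G_{t^{-1}}(x_k)\|^2-\tfrac L2\|y-x_k\|^2,$$ where $\mathcal G_{t^{-1}}(x_k):=t^{-1}(x_k-x_{k+1})$.
   Context: **Problem.** $F(x)=g(x)+h(C(x))+s(R(x))$ on $\mathbb R^m$, where $g:\mathbb R^m\to\mathbb R\cup\{+\infty\}$ is proper, closed, convex; $h:\mathbb R^d\to\mathbb R$ is finite-valued, closed, convex; $C:\mathbb R^m\to\mathbb R^d$ and $s:\mathbb R^n\to\mathbb R$ are $\mathcal C^1$; $R=(r_1,\dots,r_n)$ with each $r_i:\mathbb R^m\to\mathbb R$ finite-valued, closed, convex. $\|\cdot\|$ is the Euclidean norm; $\|u\|_Q^2:=u^\top Qu$. **Standing assumptions.** (1) Monotone-or-smooth: for each $\bar x\in\operatorname{dom}F$ there is a neighborhood $W$ of $R(\bar x)$ such that, for every $i$, if $r_i$ is not $\mathcal C^1$ on any neighborhood of $\bar x$ then $\nabla_i s(z)\ge0$ for all $z\in W$. (2) $x_0\in\operatorname{dom}F$ and $\mathcal X_0:=\{x\in\operatorname{dom}F: F(x)\le F(x_0)\}$ is nonempty and compact. (3) $h$ is $L_h$-Lipschitz; $C$ has $\beta_C$-Lipschitz Jacobian; $s$ has $\beta_s$-Lipschitz gradient; each $r_i$ is $L_{r_i}$-Lipschitz,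 $L_R:=\|(L_{r_1},\dots,L_{r_n})\|_2$. (4) Let $\mathcal I^-$ be the set of indices $i$ with $\nabla_i s(R(x))<0$ for some $x\in\mathcal X_0$. If $\mathcal I^-\ne\emptyset$, then $\|\nabla s(y)\|\le L_s$ for all $y\in\{R(x):F(x)\le F(x_0)\}$, and each $r_i$, $i\in\mathcal I^-$, is $\mathcal C^1$ with $\beta_{r_i}$-Lipschitz gradient; $\beta_R:=(\sum_{i\in\mathcal I^-}\beta_{r_i}^2)^{1/2}$. (In the paper the two-sided bound is used with $L_U=L_h\beta_C+L_R^2\beta_s$ and $L_L=L_U+L_s\beta_R$.) **Model.** For $x_k\in\mathcal X_0$, $$F(x;x_k)=g(x)+h\big(C(x_k)+\nabla C(x_k)(x-x_k)\big)+s(R(x_k))+\sum_{i=1}^n\nabla_i s(R(x_k))\,\Phi_i(x;x_k),$$ where $\Phi_i(x;x_k)=r_i(x)-r_i(x_k)$ if $\nabla_i s(R(x_k))\ge0$, and $\Phi_i(x;x_k)=\nabla r_i(x_k)^\top(x-x_k)$ if $\nabla_i s(R(x_k))<0$. $F(\cdot;x_k)$ is convex. The proximal model is $F_{Q_k}(x;x_k)=F(x;x_k)+\tfrac12\|x-x_k\|_{Q_k}^2$.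
   Formalization: The second inequality and its special case y = x_k are proved under the added assumption L_U ≥ 0 (true of the paper's L_U = L_hβ_C + L_R²β_s); for negative L_U they can fail, e.g. s(z) = −|z|², R = id, Q = diag(1,100). *)

theory Defs
  imports "HOL-Analysis.Analysis"
begin

section \<open>Convex functions and first derivatives\<close>

text \<open>The library's \<^const>\<open>epigraph\<close> is for real-valued functions only; in both cases
  the epigraph contains pairs with a finite second component. Closedness of a function means
  closedness of its epigraph, i.e. lower semicontinuity.\<close>

definition ereal_epigraph :: "('a \<Rightarrow> ereal) \<Rightarrow> ('a \<times> real) set" where
  "ereal_epigraph f = {(x, t). f x \<le> ereal t}"

definition eff_dom :: "('a \<Rightarrow> ereal) \<Rightarrow> 'a set" where
  "eff_dom f = {x. f x < \<infinity>}"

definition proper :: "('a \<Rightarrow> ereal) \<Rightarrow> bool" where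
  "proper f \<longleftrightarrow> (\<forall>x. f x \<noteq> -\<infinity>) \<and> eff_dom f \<noteq> {}"

definition proper_closed_convex :: "('a::euclidean_space \<Rightarrow> ereal) \<Rightarrow> bool" where
  "proper_closed_convex f \<longleftrightarrow>
     proper f \<and> closed (ereal_epigraph f) \<and> convex (ereal_epigraph f)"

definition closed_convex :: "('a::euclidean_space \<Rightarrow> real) \<Rightarrow> bool" where
  "closed_convex f \<longleftrightarrow> closed (epigraph UNIV f) \<and> convex_on UNIV f"

text \<open>The derivative as an element of the normed space of bounded linear maps, so that continuity
  and Lipschitz continuity of the Jacobian refer to the operator norm induced by the
  Euclidean norms. Only meaningful at points of differentiability.\<close>

definition fderiv_map ::
    "('a::euclidean_space \<Rightarrow> 'b::euclidean_space) \<Rightarrow> 'a \<Rightarrow> 'a \<Rightarrow>\<^sub>L 'b" where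
  "fderiv_map f x = Blinfun (frechet_derivative f (at x))"

definition C1_on :: "'a set \<Rightarrow> ('a::euclidean_space \<Rightarrow> 'b::euclidean_space) \<Rightarrow> bool" where
  "C1_on U f \<longleftrightarrow> (\<forall>x\<in>U. f differentiable (at x)) \<and> continuous_on U (fderiv_map f)"

definition grad :: "(real^'k \<Rightarrow> real) \<Rightarrow> real^'k \<Rightarrow> real^'k" where
  "grad f x = (\<chi> i. frechet_derivative f (at x) (axis i 1))"

section \<open>Symmetric positive definite matrices\<close>

definition sym_pos_def :: "real^'k^'k \<Rightarrow> bool" where
  "sym_pos_def Q \<longleftrightarrow> transpose Q = Q \<and> (\<forall>v. v \<noteq> 0 \<longrightarrow> v \<bullet> (Q *v v) > 0)"

definition sqnorm_wrt :: "real^'k^'k \<Rightarrow> real^'k \<Rightarrow> real" where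
  "sqnorm_wrt Q u = u \<bullet> (Q *v u)"

text \<open>The smallest real eigenvalue; it exists for symmetric matrices.\<close>

definition lambda_min :: "real^'k^'k \<Rightarrow> real" where
  "lambda_min Q = (LEAST l. \<exists>v. v \<noteq> 0 \<and> Q *v v = l *\<^sub>R v)"

section \<open>The composite problem and its convex models\<close>

definition objective ::
    "(real^'m \<Rightarrow> ereal) \<Rightarrow> (real^'d \<Rightarrow> real) \<Rightarrow> (real^'m \<Rightarrow> real^'d) \<Rightarrow> (real^'n \<Rightarrow> real)
      \<Rightarrow> (real^'m \<Rightarrow> real^'n) \<Rightarrow> real^'m \<Rightarrow> ereal" where
  "objective g h C s R x = g x + ereal (h (C x) + s (R x))"

definition sublevel ::
    "(real^'m \<Rightarrow> ereal) \<Rightarrow> (real^'d \<Rightarrow> real) \<Rightarrow> (real^'m \<Rightarrow> real^'d) \<Rightarrow> (real^'n \<Rightarrow> real)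
      \<Rightarrow> (real^'m \<Rightarrow> real^'n) \<Rightarrow> real^'m \<Rightarrow> (real^'m) set" where
  "sublevel g h C s R x0 =
     {x \<in> eff_dom (objective g h C s R). objective g h C s R x \<le> objective g h C s R x0}"

definition inner_model ::
    "(real^'n \<Rightarrow> real) \<Rightarrow> (real^'m \<Rightarrow> real^'n) \<Rightarrow> real^'m \<Rightarrow> 'n \<Rightarrow> real^'m \<Rightarrow> real" where
  "inner_model s R xk i x =
     (if grad s (R xk) $ i \<ge> 0 then R x $ i - R xk $ i
      else grad (\<lambda>z. R z $ i) xk \<bullet> (x - xk))"

definition model ::
    "(real^'m \<Rightarrow> ereal) \<Rightarrow> (real^'d \<Rightarrow> real) \<Rightarrow> (real^'m \<Rightarrow> real^'d) \<Rightarrow> (real^'n \<Rightarrow> real)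
      \<Rightarrow> (real^'m \<Rightarrow> real^'n) \<Rightarrow> real^'m \<Rightarrow> real^'m \<Rightarrow> ereal" where
  "model g h C s R xk x =
     g x + ereal (h (C xk + frechet_derivative C (at xk) (x - xk)) + s (R xk)
       + (\<Sum>i\<in>UNIV. grad s (R xk) $ i * inner_model s R xk i x))"

definition prox_model ::
    "(real^'m \<Rightarrow> ereal) \<Rightarrow> (real^'d \<Rightarrow> real) \<Rightarrow> (real^'m \<Rightarrow> real^'d) \<Rightarrow> (real^'n \<Rightarrow> real)
      \<Rightarrow> (real^'m \<Rightarrow> real^'n) \<Rightarrow> real^'m^'m \<Rightarrow> real^'m \<Rightarrow> real^'m \<Rightarrow> ereal" where
  "prox_model g h C s R Q xk x = model g h C s R xk x + ereal (1/2 * sqnorm_wrt Q (x - xk))"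

definition neg_indices ::
    "(real^'m \<Rightarrow> ereal) \<Rightarrow> (real^'d \<Rightarrow> real) \<Rightarrow> (real^'m \<Rightarrow> real^'d) \<Rightarrow> (real^'n \<Rightarrow> real)
      \<Rightarrow> (real^'m \<Rightarrow> real^'n) \<Rightarrow> real^'m \<Rightarrow> 'n set" where
  "neg_indices g h C s R x0 = {i. \<exists>x \<in> sublevel g h C s R x0. grad s (R x) $ i < 0}"

text \<open>On the effective domain both terms of the difference are finite.\<close>

definition two_sided_bound ::
    "(real^'m \<Rightarrow> ereal) \<Rightarrow> (real^'d \<Rightarrow> real) \<Rightarrow> (real^'m \<Rightarrow> real^'d) \<Rightarrow> (real^'n \<Rightarrow> real)
      \<Rightarrow> (real^'m \<Rightarrow> real^'n) \<Rightarrow> real^'m \<Rightarrow> real \<Rightarrow> real \<Rightarrow> bool" where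
  "two_sided_bound g h C s R xk L_L L_U \<longleftrightarrow>
     (\<forall>x \<in> eff_dom (objective g h C s R).
        ereal (- (L_L / 2) * (norm (x - xk))\<^sup>2) \<le> objective g h C s R x - model g h C s R xk x \<and>
        objective g h C s R x - model g h C s R xk x \<le> ereal (L_U / 2 * (norm (x - xk))\<^sup>2))"

text \<open>In \<open>monotone_or_smooth\<close>, the neighbourhood \<open>W\<close> is common to all indices \<open>i\<close>.\<close>

locale composite_problem =
  fixes g :: "real^'m \<Rightarrow> ereal"
    and h :: "real^'d \<Rightarrow> real"
    and C :: "real^'m \<Rightarrow> real^'d"
    and s :: "real^'n \<Rightarrow> real"
    and R :: "real^'m \<Rightarrow> real^'n"
    and x0 :: "real^'m"
    and L_h \<beta>_C \<beta>_s L_s :: real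
    and L_r \<beta>_r :: "'n \<Rightarrow> real"
  assumes g: "proper_closed_convex g"
    and h: "closed_convex h"
    and C: "C1_on UNIV C"
    and s: "C1_on UNIV s"
    and r: "closed_convex (\<lambda>x. R x $ i)"
    and monotone_or_smooth:
      "xbar \<in> eff_dom (objective g h C s R) \<Longrightarrow>
        \<exists>W. open W \<and> R xbar \<in> W \<and>
          (\<forall>i. (\<nexists>U. open U \<and> xbar \<in> U \<and> C1_on U (\<lambda>x. R x $ i)) \<longrightarrow>
               (\<forall>z\<in>W. grad s z $ i \<ge> 0))"
    and x0: "x0 \<in> eff_dom (objective g h C s R)"
    and sublevel_nonempty: "sublevel g h C s R x0 \<noteq> {}"
    and sublevel_compact: "compact (sublevel g h C s R x0)"
    and h_lipschitz: "L_h-lipschitz_on UNIV h"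
    and C_lipschitz: "\<beta>_C-lipschitz_on UNIV (fderiv_map C)"
    and s_lipschitz: "\<beta>_s-lipschitz_on UNIV (grad s)"
    and r_lipschitz: "(L_r i)-lipschitz_on UNIV (\<lambda>x. R x $ i)"
    and grad_s_bound:
      "\<lbrakk>neg_indices g h C s R x0 \<noteq> {}; objective g h C s R x \<le> objective g h C s R x0\<rbrakk>
        \<Longrightarrow> norm (grad s (R x)) \<le> L_s"
    and r_neg_C1: "i \<in> neg_indices g h C s R x0 \<Longrightarrow> C1_on UNIV (\<lambda>x. R x $ i)"
    and r_neg_lipschitz:
      "i \<in> neg_indices g h C s R x0 \<Longrightarrow> (\<beta>_r i)-lipschitz_on UNIV (grad (\<lambda>x. R x $ i))"

end

theory Submission
  imports Defs
begin

text \<open>Write \<open>q = \<parallel>x\<^sub>k - x\<^sub>k\<^sub>+\<^sub>1\<parallel>\<^sub>Q\<^sup>2\<close>. The convex model \<open>F(\<cdot>; x\<^sub>k)\<close> plus the quadratic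
  \<open>\<parallel>\<cdot> - x\<^sub>k\<parallel>\<^sub>Q\<^sup>2 / 2\<close> is minimal at \<open>x\<^sub>k\<^sub>+\<^sub>1\<close>, so \<open>\<G> = Q (x\<^sub>k - x\<^sub>k\<^sub>+\<^sub>1)\<close>, the negative gradient of the
  quadratic there, is a subgradient of the model at \<open>x\<^sub>k\<^sub>+\<^sub>1\<close> (\<open>prox_three_point\<close>). To see
  this directly, compare the minimal value with the value at a point
  of the segment from \<open>x\<^sub>k\<^sub>+\<^sub>1\<close> to \<open>y\<close>, use convexity, and let the point tend to \<open>x\<^sub>k\<^sub>+\<^sub>1\<close>. Splitting
  \<open>y - x\<^sub>k\<^sub>+\<^sub>1 = (y - x\<^sub>k) + (x\<^sub>k - x\<^sub>k\<^sub>+\<^sub>1)\<close> in the subgradient inequality produces a full \<open>q\<close>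
  (\<open>model_lower_bound\<close>); half of it is the proximal term at \<open>x\<^sub>k\<^sub>+\<^sub>1\<close>, the other half the last term of the
  first inequality.

  To pass from the model to \<open>F\<close>, apply the lower bound on \<open>F - F(\<cdot>; x\<^sub>k)\<close> at \<open>y\<close> and the upper
  bound at \<open>x\<^sub>k\<^sub>+\<^sub>1\<close>. The latter costs \<open>L\<^sub>U / 2 \<cdot> \<parallel>x\<^sub>k\<^sub>+\<^sub>1 - x\<^sub>k\<parallel>\<^sup>2\<close>, which has to be expressed as a fraction
  \<open>\<kappa>\<close> of \<open>q\<close> (\<open>objective_lower_bound\<close>). For general \<open>Q\<close> the Rayleigh inequality
  \<open>\<lambda>\<^sub>m\<^sub>i\<^sub>n(Q) \<parallel>v\<parallel>\<^sup>2 \<le> \<parallel>v\<parallel>\<^sub>Q\<^sup>2\<close> gives \<open>\<kappa> = L\<^sub>U / (2 \<lambda>\<^sub>m\<^sub>i\<^sub>n(Q))\<close>; it holds because a minimizer of the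
  Rayleigh quotient is an eigenvector for the least eigenvalue (\<open>lambda_min_Rayleigh\<close>).
  For \<open>Q = t\<^sup>-\<^sup>1 I\<close> the two norms are proportional, so \<open>\<kappa> = L t / 2\<close> is exact and works for \<open>L\<close> of either
  sign.\<close>

section \<open>Quadratic forms of symmetric matrices\<close>

text \<open>The first-order condition at the left end of an interval, for a perturbation whose
  remainder is quadratic. It serves twice: for Rayleigh quotients and for proximal steps.\<close>

lemma linear_coeff_nonneg:
  fixes b c :: real
  assumes "\<And>u. \<lbrakk>0 < u; u \<le> 1\<rbrakk> \<Longrightarrow> 0 \<le> u * b + u\<^sup>2 * c"
  shows "0 \<le> b"
proof (rule tendsto_lowerbound)
  show "((\<lambda>u. b + u * c) \<longlongrightarrow> b) (at_right 0)"
    by (auto intro!: tendsto_eq_intros)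
  have "0 \<le> b + u * c" if "0 < u" "u < 1" for u
  proof -
    have "0 \<le> u * (b + u * c)"
      using assms[of u] that by (simp add: algebra_simps power2_eq_square)
    then show ?thesis
      using that by (simp add: zero_le_mult_iff)
  qed
  then show "\<forall>\<^sub>F u in at_right 0. 0 \<le> b + u * c"
    unfolding eventually_at_right_field by (intro exI[of _ 1]) auto
qed simp

lemma inner_matrix_symmetric:
  fixes Q :: "real^'k^'k"
  assumes "transpose Q = Q"
  shows "u \<bullet> (Q *v w) = (Q *v u) \<bullet> w"
  using assms by (metis dot_lmul_matrix transpose_matrix_vector)

lemma sqnorm_wrt_add_scaleR:
  assumes "transpose Q = Q"
  shows "sqnorm_wrt Q (v + a *\<^sub>R w)
    = sqnorm_wrt Q v + 2 * a * ((Q *v v) \<bullet> w) + a\<^sup>2 * sqnorm_wrt Q w"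
  unfolding sqnorm_wrt_def
  using inner_matrix_symmetric[OF assms, of v w]
  by (simp add: matrix_vector_right_distrib matrix_vector_mult_scaleR inner_add_left
      inner_add_right inner_commute power2_eq_square algebra_simps)

lemma sqnorm_wrt_scaleR: "sqnorm_wrt Q (a *\<^sub>R w) = a\<^sup>2 * sqnorm_wrt Q w"
  by (simp add: sqnorm_wrt_def matrix_vector_mult_scaleR power2_eq_square)

lemma sqnorm_wrt_minus_commute: "sqnorm_wrt Q (u - w) = sqnorm_wrt Q (w - u)"
  using sqnorm_wrt_scaleR[of Q "-1" "u - w"] by simp

lemma Rayleigh_minimizer_exists:
  fixes Q :: "real^'k^'k"
  obtains v where "norm v = 1" "\<And>w. sqnorm_wrt Q v * (norm w)\<^sup>2 \<le> sqnorm_wrt Q w"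
proof -
  have "continuous_on (sphere 0 1) (sqnorm_wrt Q)"
    unfolding sqnorm_wrt_def
    by (intro continuous_intros linear_continuous_on matrix_vector_mul_bounded_linear)
  moreover have "axis undefined 1 \<in> sphere (0::real^'k) 1"
    by (simp add: norm_axis_1)
  then have "sphere (0::real^'k) 1 \<noteq> {}"
    by blast
  ultimately obtain v where v: "v \<in> sphere 0 1"
    and min: "\<And>u. u \<in> sphere 0 1 \<Longrightarrow> sqnorm_wrt Q v \<le> sqnorm_wrt Q u"
    using continuous_attains_inf[OF compact_sphere] by blast
  have "sqnorm_wrt Q v * (norm w)\<^sup>2 \<le> sqnorm_wrt Q w" for w
  proof (cases "w = 0")
    case True
    then show ?thesis by (simp add: sqnorm_wrt_def)
  next
    case False
    then have "sqnorm_wrt Q v * (norm w)\<^sup>2 \<le> sqnorm_wrt Q (w /\<^sub>R norm w) * (norm w)\<^sup>2"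
      by (intro mult_right_mono min) auto
    also have "\<dots> = sqnorm_wrt Q w"
      using False by (simp add: sqnorm_wrt_scaleR power_inverse)
    finally show ?thesis .
  qed
  with v show thesis by (intro that[of v]) auto
qed

text \<open>Move from \<open>v\<close> against the residual \<open>e = Q v - \<mu> v\<close>: to first order, the nonnegative form
  \<open>\<parallel>w\<parallel>\<^sub>Q\<^sup>2 - \<mu> \<parallel>w\<parallel>\<^sup>2\<close>, which vanishes at \<open>v\<close>, changes by \<open>- 2 u \<parallel>e\<parallel>\<^sup>2\<close>, so the residual is zero.\<close>

lemma Rayleigh_minimizer_eigenvector:
  fixes Q :: "real^'k^'k"
  assumes sym: "transpose Q = Q" and "norm v = 1"
    and min: "\<And>w. sqnorm_wrt Q v * (norm w)\<^sup>2 \<le> sqnorm_wrt Q w"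
  shows "Q *v v = sqnorm_wrt Q v *\<^sub>R v"
proof -
  define \<mu> where "\<mu> = sqnorm_wrt Q v"
  define e where "e = Q *v v - \<mu> *\<^sub>R v"
  have nv: "v \<bullet> v = 1"
    using \<open>norm v = 1\<close> by (simp add: dot_square_norm)
  have Qv: "(Q *v v) \<bullet> e = e \<bullet> e + \<mu> * (v \<bullet> e)"
    by (simp add: e_def inner_diff_left)
  have "0 \<le> u * (- 2 * (e \<bullet> e)) + u\<^sup>2 * (sqnorm_wrt Q e - \<mu> * (e \<bullet> e))" for u
  proof -
    define z where "z = v + (- u) *\<^sub>R e"
    have "sqnorm_wrt Q z = \<mu> - 2 * u * (e \<bullet> e + \<mu> * (v \<bullet> e)) + u\<^sup>2 * sqnorm_wrt Q e"
      unfolding z_def \<mu>_def[symmetric] Qv[symmetric] sqnorm_wrt_add_scaleR[OF sym] by simp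
    moreover have "(norm z)\<^sup>2 = 1 - 2 * u * (v \<bullet> e) + u\<^sup>2 * (e \<bullet> e)"
      unfolding power2_norm_eq_inner z_def using nv
      by (simp add: inner_diff_left inner_diff_right inner_commute power2_eq_square algebra_simps)
    moreover have "\<mu> * (norm z)\<^sup>2 \<le> sqnorm_wrt Q z"
      unfolding \<mu>_def by (rule min)
    ultimately show ?thesis
      by (simp only:) (simp add: algebra_simps)
  qed
  then have "0 \<le> - 2 * (e \<bullet> e)"
    by (rule linear_coeff_nonneg)
  then have "e = 0"
    using inner_ge_zero[of e] inner_eq_zero_iff[of e] by linarith
  then show ?thesis by (simp add: e_def \<mu>_def)
qed

text \<open>The minimal Rayleigh quotient is an eigenvalue, and every other eigenvalue is the
  Rayleigh quotient of its eigenvector. This identifies the \<open>LEAST\<close> in the definition.\<close>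

lemma lambda_min_Rayleigh:
  fixes Q :: "real^'k^'k"
  assumes sym: "transpose Q = Q"
  obtains v where "norm v = 1" "lambda_min Q = sqnorm_wrt Q v"
    "\<And>w. lambda_min Q * (norm w)\<^sup>2 \<le> sqnorm_wrt Q w"
proof -
  obtain v where v: "norm v = 1"
    and min: "\<And>w. sqnorm_wrt Q v * (norm w)\<^sup>2 \<le> sqnorm_wrt Q w"
    using Rayleigh_minimizer_exists[of Q] by blast
  have "lambda_min Q = sqnorm_wrt Q v"
    unfolding lambda_min_def
  proof (rule Least_equality)
    show "\<exists>u. u \<noteq> 0 \<and> Q *v u = sqnorm_wrt Q v *\<^sub>R u"
      using Rayleigh_minimizer_eigenvector[OF sym v min] v by (intro exI[of _ v]) auto
  next
    fix l assume "\<exists>u. u \<noteq> 0 \<and> Q *v u = l *\<^sub>R u"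
    then obtain u where "u \<noteq> 0" "Q *v u = l *\<^sub>R u" by blast
    then show "sqnorm_wrt Q v \<le> l"
      using min[of u] by (simp add: sqnorm_wrt_def dot_square_norm)
  qed
  with v min show thesis by (intro that[of v]) auto
qed

lemma lambda_min_pos:
  assumes "sym_pos_def Q"
  shows "0 < lambda_min Q"
proof -
  obtain v where "norm v = 1" "lambda_min Q = sqnorm_wrt Q v"
    using lambda_min_Rayleigh assms unfolding sym_pos_def_def by metis
  moreover have "v \<noteq> 0"
    using \<open>norm v = 1\<close> by auto
  ultimately show ?thesis
    using assms by (simp add: sym_pos_def_def sqnorm_wrt_def)
qed

lemma lambda_min_scaled_mat: "lambda_min (c *\<^sub>R mat 1 :: real^'k^'k) = c"
  unfolding lambda_min_def
proof (rule Least_equality)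
  show "\<exists>v. v \<noteq> 0 \<and> (c *\<^sub>R mat 1 :: real^'k^'k) *v v = c *\<^sub>R v"
    by (intro exI[of _ "axis undefined 1"])
       (auto simp: axis_eq_0_iff scaleR_matrix_vector_assoc[symmetric])
qed (auto simp: scaleR_matrix_vector_assoc[symmetric])

lemma matrix_inv_mult_vector_pos_def:
  assumes "sym_pos_def Q"
  shows "matrix_inv Q *v (Q *v u) = u"
proof -
  have "v = 0" if "Q *v v = 0" for v
    using assms that unfolding sym_pos_def_def by force
  then have "invertible Q"
    by (simp add: invertible_left_inverse matrix_left_invertible_ker)
  then have "matrix_inv Q ** Q = mat 1"
    unfolding invertible_def matrix_inv_def by (metis (mono_tags, lifting) someI_ex)
  then show ?thesis
    by (simp add: matrix_vector_mul_assoc)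
qed

section \<open>Proximal steps on convex functions\<close>

lemma ereal_epigraph_convexD:
  fixes g :: "'a::real_vector \<Rightarrow> ereal"
  assumes "convex (ereal_epigraph g)" "g x \<le> ereal a" "g y \<le> ereal b" "0 \<le> u" "u \<le> 1"
  shows "g ((1 - u) *\<^sub>R x + u *\<^sub>R y) \<le> ereal ((1 - u) * a + u * b)"
  using convexD[OF assms(1), of "(x, a)" "(y, b)" "1 - u" u] assms(2-)
  by (simp add: ereal_epigraph_def)

text \<open>The optimality condition of the proximal step, in subgradient form. At
  \<open>z = (1 - u) x + u y\<close> minimality of \<open>x\<close> and convexity of \<open>g + \<phi>\<close> leave, after cancelling the
  terms at \<open>x\<close>, a quadratic polynomial in \<open>u\<close> whose linear coefficient is the gap in the claim.\<close>

lemma prox_three_point: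
  fixes g :: "real^'m \<Rightarrow> ereal" and \<phi> :: "real^'m \<Rightarrow> real"
  assumes g: "convex (ereal_epigraph g)" and \<phi>: "convex_on UNIV \<phi>"
    and sym: "transpose Q = Q"
    and min: "\<And>z. g x + ereal (\<phi> x) + ereal (1/2 * sqnorm_wrt Q (x - c))
                    \<le> g z + ereal (\<phi> z) + ereal (1/2 * sqnorm_wrt Q (z - c))"
    and x: "g x = ereal a" and y: "g y = ereal b"
  shows "a + \<phi> x + (Q *v (c - x)) \<bullet> (y - x) \<le> b + \<phi> y"
proof -
  have "0 \<le> u * (b + \<phi> y - a - \<phi> x - (Q *v (c - x)) \<bullet> (y - x))
             + u\<^sup>2 * (1/2 * sqnorm_wrt Q (y - x))" if u: "0 < u" "u \<le> 1" for u
  proof -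
    define z where "z = (1 - u) *\<^sub>R x + u *\<^sub>R y"
    have gz: "g z \<le> ereal ((1 - u) * a + u * b)"
      unfolding z_def using ereal_epigraph_convexD[OF g, of x a y b u] x y u by simp
    have "ereal (a + \<phi> x + 1/2 * sqnorm_wrt Q (x - c))
            \<le> g z + ereal (\<phi> z) + ereal (1/2 * sqnorm_wrt Q (z - c))"
      using min[of z] x by simp
    also have "\<dots> \<le> ereal ((1 - u) * a + u * b + \<phi> z + 1/2 * sqnorm_wrt Q (z - c))"
      using gz by (cases "g z") auto
    finally have "a + \<phi> x + 1/2 * sqnorm_wrt Q (x - c)
                   \<le> (1 - u) * a + u * b + \<phi> z + 1/2 * sqnorm_wrt Q (z - c)"
      by simp
    moreover have "\<phi> z \<le> (1 - u) * \<phi> x + u * \<phi> y"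
      unfolding z_def using convex_onD[OF \<phi>, of u x y] u by simp
    moreover have "z - c = (x - c) + u *\<^sub>R (y - x)"
      by (simp add: z_def algebra_simps)
    moreover have "Q *v (x - c) = - (Q *v (c - x))"
      by (simp add: matrix_vector_mult_diff_distrib)
    moreover have "sqnorm_wrt Q ((x - c) + u *\<^sub>R (y - x)) = sqnorm_wrt Q (x - c)
        + 2 * u * ((Q *v (x - c)) \<bullet> (y - x)) + u\<^sup>2 * sqnorm_wrt Q (y - x)"
      by (rule sqnorm_wrt_add_scaleR[OF sym])
    ultimately show ?thesis
      by (simp add: left_diff_distrib right_diff_distrib distrib_left)
  qed
  then have "0 \<le> b + \<phi> y - a - \<phi> x - (Q *v (c - x)) \<bullet> (y - x)"
    by (rule linear_coeff_nonneg)
  then show ?thesis by simp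
qed

section \<open>The convex model\<close>

text \<open>The model is \<^term>\<open>g\<close> plus this real-valued convex function, so that extended reals
  enter only through \<^term>\<open>g\<close>.\<close>

definition model_real ::
    "(real^'d \<Rightarrow> real) \<Rightarrow> (real^'m \<Rightarrow> real^'d) \<Rightarrow> (real^'n \<Rightarrow> real)
      \<Rightarrow> (real^'m \<Rightarrow> real^'n) \<Rightarrow> real^'m \<Rightarrow> real^'m \<Rightarrow> real" where
  "model_real h C s R xk x =
     h (C xk + frechet_derivative C (at xk) (x - xk)) + s (R xk)
       + (\<Sum>i\<in>UNIV. grad s (R xk) $ i * inner_model s R xk i x)"

lemma convex_on_affine_precompose:
  fixes h :: "'b::real_vector \<Rightarrow> real" and A :: "'a::real_vector \<Rightarrow> 'b"
  assumes h: "convex_on UNIV h" and A: "linear A"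
  shows "convex_on UNIV (\<lambda>x. h (p + A (x - c)))"
proof (rule convex_onI)
  fix u :: real and x y assume u: "0 < u" "u < 1"
  have "p + A ((1 - u) *\<^sub>R x + u *\<^sub>R y - c)
         = (1 - u) *\<^sub>R (p + A (x - c)) + u *\<^sub>R (p + A (y - c))"
    by (simp add: linear_diff[OF A] linear_add[OF A] linear_scale[OF A] algebra_simps)
  then show "h (p + A ((1 - u) *\<^sub>R x + u *\<^sub>R y - c))
              \<le> (1 - u) * h (p + A (x - c)) + u * h (p + A (y - c))"
    using convex_onD[OF h, of u "p + A (x - c)" "p + A (y - c)"] u by simp
qed auto

lemma convex_on_sum_fun:
  fixes f :: "'i \<Rightarrow> 'a::real_vector \<Rightarrow> real"
  assumes "\<And>i. convex_on UNIV (f i)"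
  shows "convex_on UNIV (\<lambda>x. \<Sum>i\<in>I. f i x)"
  by (induction I rule: infinite_finite_induct)
     (use assms in \<open>auto simp: convex_on_const\<close>)

text \<open>The linearization inside \<^term>\<open>h\<close> is affine. In the sum, a nonnegative
  weight multiplies the convex function \<open>r\<^sub>i\<close>, and a negative weight only ever meets an affine
  function, by the case distinction in \<^const>\<open>inner_model\<close>.\<close>

lemma convex_model_real:
  assumes h: "convex_on UNIV h" and C: "C differentiable (at xk)"
    and R: "\<And>i. convex_on UNIV (\<lambda>x. R x $ i)"
  shows "convex_on UNIV (model_real h C s R xk)"
proof -
  have "convex_on UNIV (\<lambda>x. grad s (R xk) $ i * inner_model s R xk i x)" for i
  proof (cases "grad s (R xk) $ i \<ge> 0")
    case True
    then have "convex_on UNIV (\<lambda>x. grad s (R xk) $ i * (R x $ i + - (R xk $ i)))"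
      by (intro convex_on_cmul convex_on_add R) (simp_all add: convex_on_const)
    with True show ?thesis
      by (simp add: inner_model_def)
  next
    case False
    then show ?thesis
      by (intro convex_onI) (auto simp: inner_model_def inner_diff_right inner_add_right algebra_simps)
  qed
  then have "convex_on UNIV (\<lambda>x. \<Sum>i\<in>UNIV. grad s (R xk) $ i * inner_model s R xk i x)"
    by (rule convex_on_sum_fun)
  moreover have "linear (frechet_derivative C (at xk))"
    using C by (rule linear_frechet_derivative)
  ultimately show ?thesis
    unfolding model_real_def
    by (intro convex_on_add convex_on_affine_precompose[OF h]) (simp_all add: convex_on_const)
qed

lemma model_eq: "model g h C s R xk x = g x + ereal (model_real h C s R xk x)"
  by (simp add: model_def model_real_def)

section \<open>Lower bounds for the model and the objective\<close>

context composite_problem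
begin

lemma g_finite_cases:
  obtains (infinite) "g y = \<infinity>" | (finite) b where "g y = ereal b"
  using g unfolding proper_closed_convex_def proper_def by (cases "g y") auto

text \<open>The proximal model is finite at \<^term>\<open>xk\<close>, hence also at its minimizer.\<close>

lemma prox_point_in_domain:
  assumes "xk \<in> sublevel g h C s R x0"
    and "is_arg_min (prox_model g h C s R Q xk) (\<lambda>_. True) xk1"
  obtains a where "g xk1 = ereal a"
proof (cases xk1 rule: g_finite_cases)
  case infinite
  then have "prox_model g h C s R Q xk xk1 = \<infinity>"
    by (simp add: prox_model_def model_eq)
  moreover have "prox_model g h C s R Q xk xk < \<infinity>"
    using assms(1) by (cases xk rule: g_finite_cases)
      (auto simp: sublevel_def eff_dom_def objective_def prox_model_def model_eq)
  ultimately show ?thesis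
    using assms(2) by (auto simp: is_arg_min_def)
qed (use that in blast)

text \<open>The subgradient inequality at \<open>x\<^sub>k\<^sub>+\<^sub>1\<close>, recentred at \<open>x\<^sub>k\<close>; recentring contributes
  \<open>\<langle>Q (x\<^sub>k - x\<^sub>k\<^sub>+\<^sub>1), x\<^sub>k - x\<^sub>k\<^sub>+\<^sub>1\<rangle>\<close>.\<close>

lemma model_lower_bound:
  assumes xk: "xk \<in> sublevel g h C s R x0" and sym: "transpose Q = Q"
    and xk1: "is_arg_min (prox_model g h C s R Q xk) (\<lambda>_. True) xk1"
  shows "model g h C s R xk xk1 + ereal ((Q *v (xk - xk1)) \<bullet> (y - xk) + sqnorm_wrt Q (xk - xk1))
          \<le> model g h C s R xk y"
proof (cases y rule: g_finite_cases)
  case infinite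
  then show ?thesis by (simp add: model_eq)
next
  case (finite b)
  obtain a where a: "g xk1 = ereal a"
    using prox_point_in_domain[OF xk xk1] by blast
  have "prox_model g h C s R Q xk xk1 \<le> prox_model g h C s R Q xk z" for z
    using xk1 by (simp add: is_arg_min_def not_less)
  moreover have "convex_on UNIV (model_real h C s R xk)"
    using h C r by (intro convex_model_real) (simp_all add: closed_convex_def C1_on_def)
  moreover have "convex (ereal_epigraph g)"
    using g by (simp add: proper_closed_convex_def)
  ultimately have "a + model_real h C s R xk xk1 + (Q *v (xk - xk1)) \<bullet> (y - xk1)
                    \<le> b + model_real h C s R xk y"
    using sym a finite unfolding prox_model_def model_eq by (intro prox_three_point)
  moreover have "(Q *v (xk - xk1)) \<bullet> (y - xk1)
                  = (Q *v (xk - xk1)) \<bullet> (y - xk) + sqnorm_wrt Q (xk - xk1)"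
    unfolding sqnorm_wrt_def inner_commute[of "xk - xk1"] inner_add_right[symmetric] by simp
  ultimately show ?thesis
    by (simp add: model_eq a finite)
qed

text \<open>The factor \<open>\<kappa>\<close> is left open because there are two ways to choose it: from the least eigenvalue
  of \<^term>\<open>Q\<close>, and exactly when \<^term>\<open>Q\<close> is a multiple of the identity.\<close>

lemma objective_lower_bound:
  assumes xk: "xk \<in> sublevel g h C s R x0" and sym: "transpose Q = Q"
    and xk1: "is_arg_min (prox_model g h C s R Q xk) (\<lambda>_. True) xk1"
    and bound: "two_sided_bound g h C s R xk L_L L_U"
    and \<kappa>: "L_U / 2 * (norm (xk1 - xk))\<^sup>2 \<le> \<kappa> * sqnorm_wrt Q (xk - xk1)"
  shows "objective g h C s R xk1
           + ereal ((Q *v (xk - xk1)) \<bullet> (y - xk) + (1 - \<kappa>) * sqnorm_wrt Q (xk - xk1)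
                    - L_L / 2 * (norm (y - xk))\<^sup>2)
          \<le> objective g h C s R y"
proof (cases y rule: g_finite_cases)
  case infinite
  then show ?thesis by (simp add: objective_def)
next
  case (finite b)
  obtain a where a: "g xk1 = ereal a"
    using prox_point_in_domain[OF xk xk1] by blast
  have bounds: "ereal (- (L_L / 2) * (norm (x - xk))\<^sup>2)
              \<le> objective g h C s R x - model g h C s R xk x \<and>
          objective g h C s R x - model g h C s R xk x \<le> ereal (L_U / 2 * (norm (x - xk))\<^sup>2)"
    if "g x = ereal c" for x c
  proof -
    have "x \<in> eff_dom (objective g h C s R)"
      using that by (simp add: eff_dom_def objective_def)
    then show ?thesis
      using bound unfolding two_sided_bound_def by blast
  qed
  show ?thesis
    using bounds[OF a] bounds[OF finite] model_lower_bound[OF xk sym xk1, of y] \<kappa> a finite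
    by (simp add: model_eq objective_def algebra_simps)
qed

end

section \<open>The proximal descent inequalities\<close>

theorem lemma3p5:
  fixes g :: "real^'m \<Rightarrow> ereal"
    and h :: "real^'d \<Rightarrow> real"
    and C :: "real^'m \<Rightarrow> real^'d"
    and s :: "real^'n \<Rightarrow> real"
    and R :: "real^'m \<Rightarrow> real^'n"
    and x0 xk xk1 G :: "real^'m"
    and L_h \<beta>_C \<beta>_s L_s :: real
    and L_r \<beta>_r :: "'n \<Rightarrow> real"
    and Q :: "real^'m^'m"
  assumes problem: "composite_problem g h C s R x0 L_h \<beta>_C \<beta>_s L_s L_r \<beta>_r"
    and xk: "xk \<in> sublevel g h C s R x0"
    and Q: "sym_pos_def Q"
    and xk1: "is_arg_min (prox_model g h C s R Q xk) (\<lambda>_. True) xk1"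
    and G: "G = Q *v (xk - xk1)"
  shows "matrix_inv Q *v G = xk - xk1 \<and>
    (\<forall>y. model g h C s R xk y \<ge>
       prox_model g h C s R Q xk xk1 + ereal (G \<bullet> (y - xk) + 1/2 * ((matrix_inv Q *v G) \<bullet> G))) \<and>
    (\<forall>L_U L_L. L_U \<ge> 0 \<and> two_sided_bound g h C s R xk L_L L_U \<longrightarrow>
       (\<forall>y. objective g h C s R y \<ge>
          objective g h C s R xk1
          + ereal (G \<bullet> (y - xk) + (1 - L_U / (2 * lambda_min Q)) * ((matrix_inv Q *v G) \<bullet> G)
                   - L_L / 2 * (norm (y - xk))\<^sup>2)) \<and>
       objective g h C s R xk - objective g h C s R xk1 \<ge>
          ereal ((1 - L_U / (2 * lambda_min Q)) * ((matrix_inv Q *v G) \<bullet> G)) \<and>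
       (1 - L_U / (2 * lambda_min Q)) * ((matrix_inv Q *v G) \<bullet> G) =
          1/2 * (2 - L_U / lambda_min Q) * sqnorm_wrt Q (xk1 - xk)) \<and>
    (\<forall>t L. t > 0 \<and> Q = (1 / t) *\<^sub>R mat 1 \<and> two_sided_bound g h C s R xk L L \<longrightarrow>
       G = (1 / t) *\<^sub>R (xk - xk1) \<and>
       (1 - L / (2 * lambda_min Q)) * ((matrix_inv Q *v G) \<bullet> G) =
          t / 2 * (2 - L * t) * (norm G)\<^sup>2 \<and>
       (\<forall>y. objective g h C s R y \<ge>
          objective g h C s R xk1
          + ereal (G \<bullet> (y - xk) + t / 2 * (2 - L * t) * (norm G)\<^sup>2
                   - L / 2 * (norm (y - xk))\<^sup>2)))"
proof -
  interpret composite_problem g h C s R x0 L_h \<beta>_C \<beta>_s L_s L_r \<beta>_r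
    by (rule problem)
  have sym: "transpose Q = Q"
    using Q by (simp add: sym_pos_def_def)
  have inv: "matrix_inv Q *v G = xk - xk1"
    unfolding G by (rule matrix_inv_mult_vector_pos_def[OF Q])
  then have q: "(matrix_inv Q *v G) \<bullet> G = sqnorm_wrt Q (xk - xk1)"
    by (simp add: sqnorm_wrt_def G)
  obtain a where a: "g xk1 = ereal a"
    using prox_point_in_domain[OF xk xk1] by blast

  have model: "model g h C s R xk y \<ge>
      prox_model g h C s R Q xk xk1 + ereal (G \<bullet> (y - xk) + 1/2 * ((matrix_inv Q *v G) \<bullet> G))" for y
    using model_lower_bound[OF xk sym xk1, of y]
    unfolding q G[symmetric] prox_model_def sqnorm_wrt_minus_commute[of Q xk1]
    by (simp add: model_eq a algebra_simps)

  have general: "(\<forall>y. objective g h C s R y \<ge>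
          objective g h C s R xk1
          + ereal (G \<bullet> (y - xk) + (1 - L_U / (2 * lambda_min Q)) * ((matrix_inv Q *v G) \<bullet> G)
                   - L_L / 2 * (norm (y - xk))\<^sup>2)) \<and>
       objective g h C s R xk - objective g h C s R xk1 \<ge>
          ereal ((1 - L_U / (2 * lambda_min Q)) * ((matrix_inv Q *v G) \<bullet> G)) \<and>
       (1 - L_U / (2 * lambda_min Q)) * ((matrix_inv Q *v G) \<bullet> G) =
          1/2 * (2 - L_U / lambda_min Q) * sqnorm_wrt Q (xk1 - xk)"
    (is "?general L_U L_L") if "L_U \<ge> 0" and bound: "two_sided_bound g h C s R xk L_L L_U" for L_U L_L
  proof -
    \<comment> \<open>The sign of \<open>L_U\<close> matters here: the Rayleigh inequality is multiplied by it.\<close>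
    have "lambda_min Q * (norm (xk1 - xk))\<^sup>2 \<le> sqnorm_wrt Q (xk - xk1)"
      using lambda_min_Rayleigh[OF sym] by (metis norm_minus_commute)
    then have "L_U / (2 * lambda_min Q) * (lambda_min Q * (norm (xk1 - xk))\<^sup>2)
                \<le> L_U / (2 * lambda_min Q) * sqnorm_wrt Q (xk - xk1)"
      using \<open>L_U \<ge> 0\<close> lambda_min_pos[OF Q] by (intro mult_left_mono) auto
    then have \<kappa>: "L_U / 2 * (norm (xk1 - xk))\<^sup>2 \<le> L_U / (2 * lambda_min Q) * sqnorm_wrt Q (xk - xk1)"
      using lambda_min_pos[OF Q] by simp
    note descent = objective_lower_bound[OF xk sym xk1 bound \<kappa>, folded G q]
    have "objective g h C s R xk - objective g h C s R xk1 \<ge>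
          ereal ((1 - L_U / (2 * lambda_min Q)) * ((matrix_inv Q *v G) \<bullet> G))"
      using descent[of xk] a
      by (cases "objective g h C s R xk") (auto simp: objective_def)
    moreover have "(1 - L_U / (2 * lambda_min Q)) * ((matrix_inv Q *v G) \<bullet> G) =
          1/2 * (2 - L_U / lambda_min Q) * sqnorm_wrt Q (xk1 - xk)"
      unfolding q sqnorm_wrt_minus_commute[of Q xk1] by (simp add: algebra_simps)
    ultimately show ?thesis
      using descent by blast
  qed

  have scaled: "G = (1 / t) *\<^sub>R (xk - xk1) \<and>
       (1 - L / (2 * lambda_min Q)) * ((matrix_inv Q *v G) \<bullet> G) =
          t / 2 * (2 - L * t) * (norm G)\<^sup>2 \<and>
       (\<forall>y. objective g h C s R y \<ge>
          objective g h C s R xk1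
          + ereal (G \<bullet> (y - xk) + t / 2 * (2 - L * t) * (norm G)\<^sup>2
                   - L / 2 * (norm (y - xk))\<^sup>2))"
    (is "?scaled t L") if "t > 0" and Qt: "Q = (1 / t) *\<^sub>R mat 1" and bound: "two_sided_bound g h C s R xk L L" for t L
  proof -
    have Gt: "G = (1 / t) *\<^sub>R (xk - xk1)"
      by (simp add: G Qt scaleR_matrix_vector_assoc[symmetric] del: scaleR_scaleR)
    then have d: "xk - xk1 = t *\<^sub>R G"
      using \<open>t > 0\<close> by simp
    have qt: "sqnorm_wrt Q (xk - xk1) = t * (norm G)\<^sup>2"
      unfolding sqnorm_wrt_def G[symmetric] by (simp add: d dot_square_norm)
    have "(norm (xk1 - xk))\<^sup>2 = t\<^sup>2 * (norm G)\<^sup>2"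
      unfolding norm_minus_commute[of xk1 xk] d by (simp add: power_mult_distrib)
    then have \<kappa>: "L / 2 * (norm (xk1 - xk))\<^sup>2 \<le> L * t / 2 * sqnorm_wrt Q (xk - xk1)"
      by (simp add: qt power2_eq_square)
    have coeff: "(1 - L * t / 2) * sqnorm_wrt Q (xk - xk1) = t / 2 * (2 - L * t) * (norm G)\<^sup>2"
      by (simp add: qt algebra_simps)
    have "lambda_min Q = 1 / t"
      unfolding Qt by (rule lambda_min_scaled_mat)
    then have "(1 - L / (2 * lambda_min Q)) * ((matrix_inv Q *v G) \<bullet> G) =
          t / 2 * (2 - L * t) * (norm G)\<^sup>2"
      using coeff by (simp add: q)
    with Gt objective_lower_bound[OF xk sym xk1 bound \<kappa>, folded G, unfolded coeff] show ?thesis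
      by blast
  qed

  show ?thesis
  proof (rule conjI[OF inv], rule conjI, rule allI, rule model, rule conjI; intro allI impI)
    fix L_U L_L
    assume "L_U \<ge> 0 \<and> two_sided_bound g h C s R xk L_L L_U"
    then show "?general L_U L_L"
      by (intro general) auto
  next
    fix t L
    assume "t > 0 \<and> Q = (1 / t) *\<^sub>R mat 1 \<and> two_sided_bound g h C s R xk L L"
    then show "?scaled t L"
      by (intro scaled) auto
  qed
qed

end
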